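(* Posets with local dimension $3$ have bounded boolean dimension. That is, there exists an absolute constant $C$ such that every poset with local dimension $3$ has boolean dimension at most $C$.
   Context: Let $P=(X,\leq)$ be a poset. Boolean dimension: a boolean realizer of $P$ is a set $\{\leq_1,\ldots,\leq_d\}$ of (arbitrary) linear orders on $X$ for which there is a $d$-ary boolean formula $\phi$ such that for all $x,y\in X$: $x\leq y$ if and only if $\phi\bigl((x\leq_1 y),\ldots,(x\leq_d y)\bigr)$ is true, where $(x\leq_i y)$ denotes the truth value of $x\leq_i y$. The boolean dimension of $P$ is the minimum size of a boolean realizer of $P$. Local dimension: a partial linear extension of $\leq$ is a linear extension of the restriction of $\leq$ to some subset of $X$. A local realizer of $P$ of width $d$ is a set $\{\leq_1,\ldots,\leq_t\}$ of partial linear extensions of $\leq$ such that every element of $X$ occurs in (the ground sets of) at most $d$ of $\leq_1,\ldots,\leq_t$, and for all $x,y\in X$: $x\leq y$ if and only if there is no $i\in\{1,\ldots,t\}$ with $x>_i y$ (where $x>_i y$ means that both $x$ and $y$ occur in $\leq_i$ and $x$ is strictly greater than $y$ there). The local dimension of $P$ is the minimum width of a local realizer of $P$. *)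

theory Defs
  imports "HOL-Library.Extended_Nat"
begin

text \<open>A poset is a carrier \<open>X\<close> with a relation \<open>r\<close> such that \<^term>\<open>partial_order_on X r\<close>;
  \<open>(x, y) \<in> r\<close> is \<open>x \<le> y\<close>. Carriers may be infinite.\<close>

text \<open>The formula is represented by its truth function, applied to the list of the truth values of
  \<open>x \<le>\<^sub>1 y, \<dots>, x \<le>\<^sub>d y\<close>. Distinctness of the enumeration makes \<open>d\<close> the size of the
  set \<open>R\<close>, which is in particular finite.\<close>

definition boolean_realizer :: "'a set \<Rightarrow> 'a rel \<Rightarrow> 'a rel set \<Rightarrow> bool" where
  "boolean_realizer X r R \<longleftrightarrow>
     (\<forall>L\<in>R. linear_order_on X L) \<and>
     (\<exists>(Ls :: 'a rel list) (\<phi> :: bool list \<Rightarrow> bool).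
        distinct Ls \<and> set Ls = R \<and>
        (\<forall>x\<in>X. \<forall>y\<in>X. (x, y) \<in> r \<longleftrightarrow> \<phi> (map (\<lambda>L. (x, y) \<in> L) Ls)))"

text \<open>An infimum in \<^typ>\<open>enat\<close> is a minimum, except that it is \<open>\<infinity>\<close> when there is no realizer.\<close>

definition boolean_dim :: "'a set \<Rightarrow> 'a rel \<Rightarrow> enat" where
  "boolean_dim X r = (INF R \<in> {R. boolean_realizer X r R}. enat (card R))"

definition partial_linear_extension :: "'a set \<Rightarrow> 'a rel \<Rightarrow> 'a rel \<Rightarrow> bool" where
  "partial_linear_extension X r L \<longleftrightarrow>
     (\<exists>A\<subseteq>X. linear_order_on A L \<and> Restr r A \<subseteq> L)"

text \<open>The ground set of a partial linear extension \<open>L\<close> is \<^term>\<open>Field L\<close>, since \<open>L\<close> is reflexive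
  on it.\<close>

definition local_realizer :: "'a set \<Rightarrow> 'a rel \<Rightarrow> nat \<Rightarrow> 'a rel set \<Rightarrow> bool" where
  "local_realizer X r d R \<longleftrightarrow>
     finite R \<and>
     (\<forall>L\<in>R. partial_linear_extension X r L) \<and>
     (\<forall>x\<in>X. card {L\<in>R. x \<in> Field L} \<le> d) \<and>
     (\<forall>x\<in>X. \<forall>y\<in>X. (x, y) \<in> r \<longleftrightarrow> \<not> (\<exists>L\<in>R. (y, x) \<in> L \<and> x \<noteq> y))"

definition local_dim :: "'a set \<Rightarrow> 'a rel \<Rightarrow> enat" where
  "local_dim X r = (INF d \<in> {d. \<exists>R. local_realizer X r d R}. enat d)"

text \<open>\<open>C\<close> bounds the boolean dimension of all posets of local dimension 3 with elements in the
  given type.\<close>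

definition bounds_boolean_dim :: "'a itself \<Rightarrow> nat \<Rightarrow> bool" where
  "bounds_boolean_dim (_ :: 'a itself) C \<longleftrightarrow>
     (\<forall>(X :: 'a set) r. partial_order_on X r \<and> local_dim X r = 3 \<longrightarrow> boolean_dim X r \<le> enat C)"

text \<open>HOL cannot quantify over types inside a formula, so in \<open>\<exists>C. bounds_boolean_dim TYPE('a) C\<close> the
  number \<open>C\<close> could depend on \<open>'a\<close>. An absolute constant is expressed by two statements together:
  some \<open>C\<close> is a bound for \<^typ>\<open>nat\<close> (which covers all finite and all countable posets), and every
  bound for \<^typ>\<open>nat\<close> is a bound for every type. The second is no stronger than needed: boolean
  dimension at most \<open>C\<close> is a property of the finite subposets, by compactness.\<close>

end

theory Submission
  imports Defs "HOL-Analysis.Function_Topology"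
begin

text \<open>Let \<open>T x\<close> be the set of the at most three partial linear extensions containing \<open>x\<close>. Distinct
  elements have intersecting sets \<open>T x\<close>. A key is a function choosing an element of \<open>T x\<close> for some of
  the \<open>x\<close>; if every reversal of two elements is witnessed by a partial linear extension that some of
  \<open>N\<close> keys chooses for both, then the boolean dimension is at most \<open>2 N\<close>. If the sets \<open>T x\<close> have no
  common element, all but at most one element of each lies in a set of bounded size, so boundedly
  many keys suffice. If all contain \<open>L\<close>, then \<open>L\<close> is a linear extension of the whole poset. By
  transitivity, for \<open>x < z < y\<close> in \<open>L\<close> with \<open>x, y\<close> incomparable, \<open>T z - {L}\<close> meets \<open>T x \<union> T y\<close>. Cutting
  \<open>L\<close> greedily into blocks spanned by incomparable pairs again leaves at most one index of each
  element uncontrolled within its block, while incomparable elements lie in the same or in adjacent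
  blocks. Compactness reduces infinite posets to finite ones, and makes the constant independent of
  the type.\<close>

section \<open>Compactness\<close>

text \<open>Tychonoff: a power of the two-point discrete space is compact, and a set determined by
  finitely many coordinates is closed in it.\<close>

lemma finite_support_compactness:
  fixes C :: "('i \<Rightarrow> bool) set set"
  assumes supp: "\<And>c. c \<in> C \<Longrightarrow> \<exists>S. finite S \<and> (\<forall>f g. (\<forall>i\<in>S. f i = g i) \<longrightarrow> f \<in> c \<longrightarrow> g \<in> c)"
    and fip: "\<And>C0. finite C0 \<Longrightarrow> C0 \<subseteq> C \<Longrightarrow> \<Inter>C0 \<noteq> {}"
  shows "\<Inter>C \<noteq> {}"
proof -
  let ?T = "product_topology (\<lambda>_::'i. discrete_topology (UNIV :: bool set)) UNIV"
  have comp: "compact_space ?T"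
    by (simp add: compact_space_product_topology compact_space_discrete_topology)
  have clo: "closedin ?T c" if c: "c \<in> C" for c
  proof -
    obtain S where S: "finite S" "\<And>f g. (\<forall>i\<in>S. f i = g i) \<Longrightarrow> f \<in> c \<Longrightarrow> g \<in> c"
      using supp[OF c] by blast
    have "openin ?T (- c)"
      unfolding openin_product_topology_alt
    proof (intro conjI ballI)
      fix f assume f: "f \<in> - c"
      \<comment> \<open>The cylinder fixing \<open>f\<close> on \<open>S\<close> is a basic open
        neighbourhood of \<open>f\<close> that misses \<open>c\<close>.\<close>
      define U where "U i = (if i \<in> S then {f i} else UNIV)" for i
      have "{i. U i \<noteq> UNIV} \<subseteq> S" by (auto simp: U_def)
      then have "finite {i. U i \<noteq> UNIV}" using S(1) finite_subset by blast
      moreover have "Pi\<^sub>E UNIV U \<subseteq> - c"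
      proof
        fix g assume "g \<in> Pi\<^sub>E UNIV U"
        then have "g i \<in> U i" for i by (simp add: PiE_iff)
        then have "\<forall>i\<in>S. g i = f i" unfolding U_def by (metis singletonD)
        then show "g \<in> - c" using S(2)[of g f] f by auto
      qed
      moreover have "f \<in> Pi\<^sub>E UNIV U" by (auto simp: U_def)
      ultimately show "\<exists>U. finite {i \<in> UNIV. U i \<noteq> topspace (discrete_topology UNIV)} \<and>
          (\<forall>i\<in>UNIV. openin (discrete_topology UNIV) (U i)) \<and> f \<in> Pi\<^sub>E UNIV U \<and> Pi\<^sub>E UNIV U \<subseteq> - c"
        by (intro exI[of _ U]) auto
    qed
    then show ?thesis by (simp add: closedin_def flip: Compl_eq_Diff_UNIV)
  qed
  show ?thesis
    using comp clo fip unfolding compact_space_fip by blast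
qed

text \<open>Finitely many conditions follow from the single one for the union of their sets, so the
  finite intersection property reduces to \<open>ex\<close>.\<close>

lemma directed_compactness:
  fixes good :: "'a set \<Rightarrow> ('i \<Rightarrow> bool) \<Rightarrow> bool"
  assumes ex: "\<And>F. finite F \<Longrightarrow> F \<subseteq> X \<Longrightarrow> \<exists>f. good F f"
    and mono: "\<And>F F' f. F \<subseteq> F' \<Longrightarrow> good F' f \<Longrightarrow> good F f"
    and supp: "\<And>F. finite F \<Longrightarrow> F \<subseteq> X \<Longrightarrow>
      \<exists>S. finite S \<and> (\<forall>f g. (\<forall>i\<in>S. f i = g i) \<longrightarrow> good F f \<longrightarrow> good F g)"
  shows "\<exists>f. \<forall>F. finite F \<and> F \<subseteq> X \<longrightarrow> good F f"
proof -
  let ?FS = "{F. finite F \<and> F \<subseteq> X}"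
  have "\<Inter>((\<lambda>F. Collect (good F)) ` ?FS) \<noteq> {}"
  proof (rule finite_support_compactness)
    fix c assume "c \<in> (\<lambda>F. Collect (good F)) ` ?FS"
    then obtain F where "finite F" "F \<subseteq> X" "c = Collect (good F)" by auto
    then show "\<exists>S. finite S \<and> (\<forall>f g. (\<forall>i\<in>S. f i = g i) \<longrightarrow> f \<in> c \<longrightarrow> g \<in> c)"
      using supp[of F] by simp
  next
    fix C0 assume "finite C0" "C0 \<subseteq> (\<lambda>F. Collect (good F)) ` ?FS"
    then obtain D where D: "D \<subseteq> ?FS" "finite D" "C0 = (\<lambda>F. Collect (good F)) ` D"
      by (meson finite_subset_image)
    have "finite (\<Union>D)" "\<Union>D \<subseteq> X" using D by auto
    then obtain f where "good (\<Union>D) f" using ex by blast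
    then have "good F f" if "F \<in> D" for F using mono[OF Union_upper[OF that]] by blast
    then have "f \<in> \<Inter>C0" unfolding D(3) by blast
    then show "\<Inter>C0 \<noteq> {}" by blast
  qed
  then obtain f where "f \<in> \<Inter>((\<lambda>F. Collect (good F)) ` ?FS)" by blast
  then show ?thesis by blast
qed

section \<open>Indexed realizers\<close>

text \<open>Only the values of \<open>P\<close> on \<open>X\<close> are constrained, so such
  predicates can be read off a two-valued function and restricted without trimming a relation to its
  carrier.\<close>

definition linord :: "'a set \<Rightarrow> ('a \<Rightarrow> 'a \<Rightarrow> bool) \<Rightarrow> bool" where
  "linord X P \<longleftrightarrow> (\<forall>x\<in>X. P x x) \<and> (\<forall>x\<in>X. \<forall>y\<in>X. P x y \<or> P y x) \<and>
     (\<forall>x\<in>X. \<forall>y\<in>X. P x y \<longrightarrow> P y x \<longrightarrow> x = y) \<and>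
     (\<forall>x\<in>X. \<forall>y\<in>X. \<forall>z\<in>X. P x y \<longrightarrow> P y z \<longrightarrow> P x z)"

lemma linordI:
  assumes "\<And>x. x \<in> X \<Longrightarrow> P x x"
    and "\<And>x y. x \<in> X \<Longrightarrow> y \<in> X \<Longrightarrow> P x y \<or> P y x"
    and "\<And>x y. x \<in> X \<Longrightarrow> y \<in> X \<Longrightarrow> P x y \<Longrightarrow> P y x \<Longrightarrow> x = y"
    and "\<And>x y z. x \<in> X \<Longrightarrow> y \<in> X \<Longrightarrow> z \<in> X \<Longrightarrow> P x y \<Longrightarrow> P y z \<Longrightarrow> P x z"
  shows "linord X P"
  unfolding linord_def by (intro ballI conjI impI; (rule assms; assumption))

lemma linord_refl: "linord X P \<Longrightarrow> x \<in> X \<Longrightarrow> P x x"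
  unfolding linord_def by blast

lemma linord_total: "linord X P \<Longrightarrow> x \<in> X \<Longrightarrow> y \<in> X \<Longrightarrow> P x y \<or> P y x"
  unfolding linord_def by blast

lemma linord_antisym: "linord X P \<Longrightarrow> x \<in> X \<Longrightarrow> y \<in> X \<Longrightarrow> P x y \<Longrightarrow> P y x \<Longrightarrow> x = y"
  unfolding linord_def by meson

lemma linord_trans:
  "linord X P \<Longrightarrow> x \<in> X \<Longrightarrow> y \<in> X \<Longrightarrow> z \<in> X \<Longrightarrow> P x y \<Longrightarrow> P y z \<Longrightarrow> P x z"
  unfolding linord_def by meson

lemma linord_cong:
  assumes P: "linord X P" and eq: "\<And>x y. x \<in> X \<Longrightarrow> y \<in> X \<Longrightarrow> P x y = Q x y"
  shows "linord X Q"
proof (rule linordI)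
  show "Q x x" if "x \<in> X" for x using linord_refl[OF P] eq that by blast
  show "Q x y \<or> Q y x" if "x \<in> X" "y \<in> X" for x y using linord_total[OF P] eq that by blast
  show "x = y" if "x \<in> X" "y \<in> X" "Q x y" "Q y x" for x y
    using linord_antisym[OF P, of x y] eq that by blast
  show "Q x z" if "x \<in> X" "y \<in> X" "z \<in> X" "Q x y" "Q y z" for x y z
    using linord_trans[OF P, of x y z] eq that by blast
qed

lemma linord_linear_order_on:
  assumes P: "linord X P"
  shows "linear_order_on X {(x, y). x \<in> X \<and> y \<in> X \<and> P x y}" (is "linear_order_on X ?L")
proof -
  have "refl_on X ?L" using linord_refl[OF P] by (simp add: refl_on_def)
  moreover have "trans ?L" using linord_trans[OF P] by (auto intro!: transI)
  moreover have "antisym ?L" using linord_antisym[OF P] by (auto intro!: antisymI)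
  moreover have "total_on X ?L" using linord_total[OF P] by (simp add: total_on_def)
  ultimately show ?thesis
    unfolding linear_order_on_def partial_order_on_def preorder_on_def by auto
qed

lemma linear_order_on_linord:
  assumes "linear_order_on X L" shows "linord X (\<lambda>x y. (x, y) \<in> L)"
proof -
  have L: "refl_on X L" "trans L" "antisym L" "total_on X L"
    using assms unfolding linear_order_on_def partial_order_on_def preorder_on_def by auto
  have 1: "(x, x) \<in> L" if "x \<in> X" for x using L(1) that by (rule refl_onD)
  have 2: "(x, y) \<in> L \<or> (y, x) \<in> L" if "x \<in> X" "y \<in> X" for x y
    using L(4) 1 that unfolding total_on_def by (cases "x = y") auto
  show ?thesis
    by (rule linordI[OF 1 2 antisymD[OF L(3)] transD[OF L(2)]])
qed

text \<open>The well-ordering theorem supplies a filler for surplus indices and for elements without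
  a key.\<close>

lemma ex_linord: "\<exists>P. linord X P"
  using well_order_on[of X] linear_order_on_linord unfolding well_order_on_def by blast

lemma linord_subset: "linord X P \<Longrightarrow> Y \<subseteq> X \<Longrightarrow> linord Y P"
  unfolding linord_def by (meson subsetD)

lemma linord_pullback:
  assumes P: "linord X P" and "inj_on h Y" and "h ` Y \<subseteq> X"
  shows "linord Y (\<lambda>x y. P (h x) (h y))"
proof (rule linordI)
  have h: "h x \<in> X" if "x \<in> Y" for x using assms(3) that by blast
  show "P (h x) (h x)" if "x \<in> Y" for x by (rule linord_refl[OF P]) (rule h[OF that])
  show "P (h x) (h y) \<or> P (h y) (h x)" if "x \<in> Y" "y \<in> Y" for x y
    by (rule linord_total[OF P]) (use h that in auto)
  show "x = y" if "x \<in> Y" "y \<in> Y" "P (h x) (h y)" "P (h y) (h x)" for x y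
    using inj_onD[OF assms(2)] linord_antisym[OF P h h] that by blast
  show "P (h x) (h z)" if "x \<in> Y" "y \<in> Y" "z \<in> Y" "P (h x) (h y)" "P (h y) (h z)" for x y z
    using linord_trans[OF P h h h] that by blast
qed

text \<open>Used with keys as \<open>k\<close>: elements sharing a key are compared by the order
  that the key names. As \<open>Q a\<close> has to be linear only on the fibre of \<open>a\<close>,
  partial linear extensions can be inserted.\<close>

lemma linord_lex:
  fixes k :: "'a \<Rightarrow> 'b :: linorder"
  assumes Q: "\<And>a. linord {x\<in>X. k x = a} (Q a)"
  shows "linord X (\<lambda>x y. k x < k y \<or> k x = k y \<and> Q (k x) x y)"
proof (rule linordI)
  fix x assume x: "x \<in> X"
  then have "Q (k x) x x" using linord_refl[OF Q] by simp
  then show "k x < k x \<or> k x = k x \<and> Q (k x) x x" by blast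
next
  fix x y assume xy: "x \<in> X" "y \<in> X"
  show "(k x < k y \<or> k x = k y \<and> Q (k x) x y) \<or> k y < k x \<or> k y = k x \<and> Q (k y) y x"
  proof (cases "k x = k y")
    case True
    then have "Q (k x) x y \<or> Q (k x) y x" using linord_total[OF Q, of x "k x" y] xy by simp
    then show ?thesis unfolding True[symmetric] by blast
  next
    case False
    then have "k x < k y \<or> k y < k x" by (rule neq_iff[THEN iffD1])
    then show ?thesis by blast
  qed
next
  fix x y assume xy: "x \<in> X" "y \<in> X"
    and "k x < k y \<or> k x = k y \<and> Q (k x) x y" "k y < k x \<or> k y = k x \<and> Q (k y) y x"
  then have e: "k x = k y" "Q (k x) x y" "Q (k y) y x" 
    by (elim disjE conjE; (drule (1) less_asym)?; simp)+
  then show "x = y" using linord_antisym[OF Q, of x "k x" y] xy by simp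
next
  fix x y z assume X: "x \<in> X" "y \<in> X" "z \<in> X"
    and "k x < k y \<or> k x = k y \<and> Q (k x) x y" "k y < k z \<or> k y = k z \<and> Q (k y) y z"
  then consider "k x < k z" | "k x = k y" "k y = k z" "Q (k x) x y" "Q (k y) y z"
    by (elim disjE conjE) (simp_all add: less_trans)
  then show "k x < k z \<or> k x = k z \<and> Q (k x) x z"
  proof cases
    case 2
    then have "Q (k x) x z" using linord_trans[OF Q, of x "k x" y z] X by simp
    then show ?thesis using 2 by simp
  qed blast
qed

section \<open>Indexed counterparts of realizers\<close>

text \<open>The formula acts on the set of indices whose order holds. Orders may repeat, so a bound
  \<open>n\<close> on their number becomes a family of exactly \<open>n\<close>.\<close>

definition boolean_family ::
  "'a set \<Rightarrow> 'a rel \<Rightarrow> nat \<Rightarrow> (nat \<Rightarrow> 'a \<Rightarrow> 'a \<Rightarrow> bool) \<Rightarrow> (nat set \<Rightarrow> bool) \<Rightarrow> bool" where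
  "boolean_family X r n M \<phi> \<longleftrightarrow> (\<forall>i<n. linord X (M i)) \<and>
     (\<forall>x\<in>X. \<forall>y\<in>X. (x, y) \<in> r \<longleftrightarrow> \<phi> {i. i < n \<and> M i x y})"

text \<open>Here \<open>P i\<close> is a linear order on \<open>{x. P i x x}\<close>; that it extends the restriction of \<open>r\<close>
  follows from the last conjunct.\<close>

definition local_family ::
  "'a set \<Rightarrow> 'a rel \<Rightarrow> nat \<Rightarrow> nat \<Rightarrow> (nat \<Rightarrow> 'a \<Rightarrow> 'a \<Rightarrow> bool) \<Rightarrow> bool" where
  "local_family X r d t P \<longleftrightarrow>
     (\<forall>x\<in>X. card {i. i < t \<and> P i x x} \<le> d) \<and>
     (\<forall>i<t. linord {x\<in>X. P i x x} (P i)) \<and>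
     (\<forall>i<t. \<forall>x\<in>X. \<forall>y\<in>X. P i x y \<longrightarrow> P i x x \<and> P i y y) \<and>
     (\<forall>x\<in>X. \<forall>y\<in>X. (x, y) \<in> r \<longleftrightarrow> \<not> (\<exists>i<t. P i y x \<and> x \<noteq> y))"

text \<open>On a finite carrier only finitely many values of \<open>M\<close> and
  \<open>\<phi>\<close> matter; this supplies the finite supports for compactness.\<close>

lemma boolean_family_cong:
  assumes "boolean_family X r n M \<phi>"
    and M: "\<And>i x y. i < n \<Longrightarrow> x \<in> X \<Longrightarrow> y \<in> X \<Longrightarrow> M i x y = N i x y"
    and \<phi>: "\<And>S. S \<subseteq> {..<n} \<Longrightarrow> \<phi> S = \<psi> S"
  shows "boolean_family X r n N \<psi>"
  unfolding boolean_family_def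
proof (intro conjI allI impI ballI)
  fix i assume i: "i < n"
  then have "linord X (M i)" using assms(1) unfolding boolean_family_def by blast
  then show "linord X (N i)" by (rule linord_cong) (rule M[OF i])
next
  fix x y assume xy: "x \<in> X" "y \<in> X"
  then have "{i. i < n \<and> N i x y} = {i. i < n \<and> M i x y}" using M by blast
  moreover have "\<phi> {i. i < n \<and> M i x y} = \<psi> {i. i < n \<and> M i x y}" by (rule \<phi>) auto
  ultimately show "(x, y) \<in> r \<longleftrightarrow> \<psi> {i. i < n \<and> N i x y}"
    using assms(1) xy unfolding boolean_family_def by simp
qed

lemma local_family_cong:
  assumes "local_family X r d t P"
    and eq: "\<And>i x y. i < t \<Longrightarrow> x \<in> X \<Longrightarrow> y \<in> X \<Longrightarrow> P i x y = Q i x y"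
  shows "local_family X r d t Q"
  unfolding local_family_def
proof (intro conjI allI impI ballI)
  fix x assume "x \<in> X"
  then have "{i. i < t \<and> Q i x x} = {i. i < t \<and> P i x x}" using eq by blast
  then show "card {i. i < t \<and> Q i x x} \<le> d"
    using assms(1) \<open>x \<in> X\<close> unfolding local_family_def by simp
next
  fix i assume "i < t"
  then have "{x\<in>X. Q i x x} = {x\<in>X. P i x x}" using eq by blast
  moreover have "linord {x\<in>X. P i x x} (P i)"
    using assms(1) \<open>i < t\<close> unfolding local_family_def by blast
  then have "linord {x\<in>X. P i x x} (Q i)"
    by (rule linord_cong) (use eq \<open>i < t\<close> in blast)
  ultimately show "linord {x\<in>X. Q i x x} (Q i)" by simp
next
  fix i x y assume "i < t" "x \<in> X" "y \<in> X" "Q i x y"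
  then show "Q i x x" "Q i y y"
    using assms(1) eq unfolding local_family_def by blast+
next
  fix x y assume xy: "x \<in> X" "y \<in> X"
  then have "(\<exists>i<t. Q i y x \<and> x \<noteq> y) \<longleftrightarrow> (\<exists>i<t. P i y x \<and> x \<noteq> y)" using eq by blast
  then show "(x, y) \<in> r \<longleftrightarrow> \<not> (\<exists>i<t. Q i y x \<and> x \<noteq> y)"
    using assms(1) xy unfolding local_family_def by simp
qed

lemma boolean_family_pullback:
  assumes "boolean_family X r n M \<phi>" "inj_on h Y" "h ` Y \<subseteq> X"
    and "\<And>x y. x \<in> Y \<Longrightarrow> y \<in> Y \<Longrightarrow> (x, y) \<in> s \<longleftrightarrow> (h x, h y) \<in> r"
  shows "boolean_family Y s n (\<lambda>i x y. M i (h x) (h y)) \<phi>"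
  unfolding boolean_family_def
proof (intro conjI allI impI ballI)
  fix i assume "i < n"
  then show "linord Y (\<lambda>x y. M i (h x) (h y))"
    using linord_pullback[OF _ assms(2,3)] assms(1) unfolding boolean_family_def by blast
next
  fix x y assume "x \<in> Y" "y \<in> Y"
  moreover from this have "h x \<in> X" "h y \<in> X" using assms(3) by auto
  ultimately show "(x, y) \<in> s \<longleftrightarrow> \<phi> {i. i < n \<and> M i (h x) (h y)}"
    using assms(1,4) unfolding boolean_family_def by simp
qed

lemma local_family_pullback:
  assumes "local_family X r d t P" "inj_on h Y" "h ` Y \<subseteq> X"
    and "\<And>x y. x \<in> Y \<Longrightarrow> y \<in> Y \<Longrightarrow> (x, y) \<in> s \<longleftrightarrow> (h x, h y) \<in> r"
  shows "local_family Y s d t (\<lambda>i x y. P i (h x) (h y))"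
  unfolding local_family_def
proof (intro conjI allI impI ballI)
  fix i assume "i < t"
  then have "linord {x\<in>X. P i x x} (P i)" using assms(1) unfolding local_family_def by blast
  then show "linord {x\<in>Y. P i (h x) (h x)} (\<lambda>x y. P i (h x) (h y))"
    by (rule linord_pullback) (use assms(2,3) in \<open>auto simp: inj_on_def\<close>)
next
  fix x y assume "x \<in> Y" "y \<in> Y"
  moreover from this have "h x \<in> X" "h y \<in> X" "h x = h y \<longleftrightarrow> x = y"
    using assms(2,3) by (auto simp: inj_on_eq_iff)
  ultimately show "(x, y) \<in> s \<longleftrightarrow> \<not> (\<exists>i<t. P i (h y) (h x) \<and> x \<noteq> y)"
    using assms(1,4) unfolding local_family_def by simp
next
  fix x assume "x \<in> Y"
  then have "h x \<in> X" using assms(3) by auto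
  then show "card {i. i < t \<and> P i (h x) (h x)} \<le> d"
    using assms(1) unfolding local_family_def by blast
next
  fix i x y assume "i < t" "x \<in> Y" "y \<in> Y" "P i (h x) (h y)"
  moreover from this have "h x \<in> X" "h y \<in> X" using assms(3) by auto
  ultimately show "P i (h x) (h x)" "P i (h y) (h y)"
    using assms(1) unfolding local_family_def by blast+
qed

lemma boolean_family_subset:
  "boolean_family X r n M \<phi> \<Longrightarrow> Y \<subseteq> X \<Longrightarrow> boolean_family Y r n M \<phi>"
  by (erule boolean_family_pullback[where h = "\<lambda>x. x"]) auto

lemma local_family_subset:
  "local_family X r d t P \<Longrightarrow> Y \<subseteq> X \<Longrightarrow> local_family Y r d t P"
  by (erule local_family_pullback[where h = "\<lambda>x. x"]) auto

section \<open>Dimension bounds as existence of indexed families\<close>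

text \<open>A finite bound excludes the empty index set, whose infimum is infinite; otherwise the
  well-ordering of \<open>enat\<close> makes the infimum attained.\<close>

lemma INF_enat_le_iff: "(INF x\<in>A. enat (f x)) \<le> enat n \<longleftrightarrow> (\<exists>x\<in>A. f x \<le> n)"
proof
  assume le: "(INF x\<in>A. enat (f x)) \<le> enat n"
  then have "A \<noteq> {}" by (auto simp: top_enat_def)
  then have "(INF x\<in>A. enat (f x)) \<in> (\<lambda>x. enat (f x)) ` A"
    unfolding Inf_enat_def by (auto intro: LeastI)
  then show "\<exists>x\<in>A. f x \<le> n" using le by auto
next
  assume "\<exists>x\<in>A. f x \<le> n"
  then show "(INF x\<in>A. enat (f x)) \<le> enat n" by (meson INF_lower2 enat_ord_simps(1))
qed

lemma boolean_dim_le_iff: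
  "boolean_dim X r \<le> enat n \<longleftrightarrow> (\<exists>M \<phi>. boolean_family X r n M \<phi>)"
proof
  assume "boolean_dim X r \<le> enat n"
  then obtain R where R: "boolean_realizer X r R" "card R \<le> n"
    unfolding boolean_dim_def INF_enat_le_iff by auto
  from R(1) obtain Ls \<phi> where Ls: "distinct Ls" "set Ls = R" "\<forall>L\<in>R. linear_order_on X L"
      "\<And>x y. x \<in> X \<Longrightarrow> y \<in> X \<Longrightarrow> (x, y) \<in> r \<longleftrightarrow> \<phi> (map (\<lambda>L. (x, y) \<in> L) Ls)"
    unfolding boolean_realizer_def by blast
  define m where "m = length Ls"
  have mn: "m \<le> n" using R(2) Ls(1,2) distinct_card m_def by metis
  \<comment> \<open>Copies of \<open>W\<close> pad the realizer to \<open>n\<close> orders; the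
    formula will look at the first \<open>m\<close> indices only.\<close>
  obtain W where W: "linord X W" using ex_linord by blast
  define M where "M i = (if i < m then (\<lambda>x y. (x, y) \<in> Ls ! i) else W)" for i
  have "linord X (M i)" for i
  proof (cases "i < m")
    case True
    then have "linear_order_on X (Ls ! i)" using Ls(2,3) nth_mem unfolding m_def by blast
    then show ?thesis using True linear_order_on_linord by (simp add: M_def)
  qed (simp add: M_def W)
  moreover have "(x, y) \<in> r \<longleftrightarrow> \<phi> (map (\<lambda>i. i \<in> {i. i < n \<and> M i x y}) [0..<m])"
    if "x \<in> X" "y \<in> X" for x y
  proof -
    have "map (\<lambda>L. (x, y) \<in> L) Ls = map (\<lambda>i. i \<in> {i. i < n \<and> M i x y}) [0..<m]"
      using mn by (intro nth_equalityI) (auto simp: m_def M_def)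
    then show ?thesis using Ls(4)[OF that] by simp
  qed
  ultimately have "boolean_family X r n M (\<lambda>S. \<phi> (map (\<lambda>i. i \<in> S) [0..<m]))"
    unfolding boolean_family_def by blast
  then show "\<exists>M \<phi>. boolean_family X r n M \<phi>" by blast
next
  assume "\<exists>M \<phi>. boolean_family X r n M \<phi>"
  then obtain M \<phi> where lin: "\<And>i. i < n \<Longrightarrow> linord X (M i)"
    and M: "\<And>x y. x \<in> X \<Longrightarrow> y \<in> X \<Longrightarrow> (x, y) \<in> r \<longleftrightarrow> \<phi> {i. i < n \<and> M i x y}"
    unfolding boolean_family_def by blast
  define L where "L i = {(x, y). x \<in> X \<and> y \<in> X \<and> M i x y}" for i
  obtain Ls where Ls: "set Ls = L ` {..<n}" "distinct Ls"
    using finite_distinct_list[of "L ` {..<n}"] by auto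
  have "\<exists>j. j < length Ls \<and> Ls ! j = L i" if "i < n" for i
    using that Ls(1) by (metis imageI in_set_conv_nth lessThan_iff)
  \<comment> \<open>Equal orders collapse in \<open>Ls\<close>; \<open>p i\<close> is a position at
    which the order of index \<open>i\<close> can be looked up.\<close>
  then obtain p where p: "\<And>i. i < n \<Longrightarrow> p i < length Ls \<and> Ls ! p i = L i" by metis
  define \<psi> where "\<psi> bs = \<phi> {i. i < n \<and> bs ! p i}" for bs
  have "(x, y) \<in> r \<longleftrightarrow> \<psi> (map (\<lambda>L. (x, y) \<in> L) Ls)" if "x \<in> X" "y \<in> X" for x y
  proof -
    have "map (\<lambda>L. (x, y) \<in> L) Ls ! p i \<longleftrightarrow> M i x y" if "i < n" for i
      using p[OF that] \<open>x \<in> X\<close> \<open>y \<in> X\<close> by (simp add: L_def)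
    then have "{i. i < n \<and> M i x y} = {i. i < n \<and> map (\<lambda>L. (x, y) \<in> L) Ls ! p i}"
      by blast
    then show ?thesis using M that by (simp add: \<psi>_def)
  qed
  moreover have "\<forall>K\<in>L ` {..<n}. linear_order_on X K"
    using lin linord_linear_order_on unfolding L_def by blast
  ultimately have "boolean_realizer X r (L ` {..<n})"
    unfolding boolean_realizer_def
    by (intro conjI exI[of _ Ls] exI[of _ \<psi>] ballI Ls) blast+
  moreover have "card (L ` {..<n}) \<le> n" using card_image_le[of "{..<n}" L] by simp
  ultimately show "boolean_dim X r \<le> enat n"
    unfolding boolean_dim_def INF_enat_le_iff by blast
qed

lemma local_family_mono:
  "local_family X r d t P \<Longrightarrow> d \<le> d' \<Longrightarrow> local_family X r d' t P"
  unfolding local_family_def by (blast intro: order_trans)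

lemma local_dim_le_iff:
  "local_dim X r \<le> enat d \<longleftrightarrow> (\<exists>t P. local_family X r d t P)"
proof
  assume "local_dim X r \<le> enat d"
  then obtain d' R where d': "d' \<le> d" and "local_realizer X r d' R"
    unfolding local_dim_def INF_enat_le_iff by auto
  then have fin: "finite R" and ple: "\<And>L. L \<in> R \<Longrightarrow> partial_linear_extension X r L"
    and cd: "\<And>x. x \<in> X \<Longrightarrow> card {L\<in>R. x \<in> Field L} \<le> d'"
    and rR: "\<And>x y. x \<in> X \<Longrightarrow> y \<in> X \<Longrightarrow> (x, y) \<in> r \<longleftrightarrow> \<not> (\<exists>L\<in>R. (y, x) \<in> L \<and> x \<noteq> y)"
    unfolding local_realizer_def by blast+
  \<comment> \<open>The enumeration is injective, so counting indices is the same as counting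
    members of \<open>R\<close>.\<close>
  obtain t :: nat and f where f: "R = f ` {i. i < t}" "inj_on f {i. i < t}"
    using finite_imp_nat_seg_image_inj_on[OF fin] by blast
  define P where "P i x y \<longleftrightarrow> (x, y) \<in> f i" for i x y
  have lo: "Field (f i) \<subseteq> X \<and> linear_order_on (Field (f i)) (f i)" if i: "i < t" for i
  proof -
    obtain A where A: "A \<subseteq> X" "linear_order_on A (f i)"
      using ple[of "f i"] f(1) i unfolding partial_linear_extension_def by auto
    have "(x, x) \<in> f i" if "x \<in> A" for x
      using linord_refl[OF linear_order_on_linord[OF A(2)] that] .
    moreover have "f i \<subseteq> A \<times> A"
      using A(2) unfolding linear_order_on_def partial_order_on_def preorder_on_def by blast
    ultimately have "Field (f i) = A" unfolding Field_def by blast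
    then show ?thesis using A by simp
  qed
  have fld: "P i x x \<longleftrightarrow> x \<in> Field (f i)" if i: "i < t" for i x
    using linord_refl[OF linear_order_on_linord] lo[OF i] unfolding P_def
    by (metis FieldI1)
  have "local_family X r d' t P"
    unfolding local_family_def
  proof (intro conjI allI impI ballI)
    fix x assume x: "x \<in> X"
    have "f ` {i. i < t \<and> P i x x} = {L\<in>R. x \<in> Field L}" using f(1) fld by auto
    moreover have "inj_on f {i. i < t \<and> P i x x}" using f(2) by (auto simp: inj_on_def)
    ultimately show "card {i. i < t \<and> P i x x} \<le> d'" using cd[OF x] by (metis card_image)
  next
    fix i assume i: "i < t"
    have "{x\<in>X. P i x x} = Field (f i)" using fld[OF i] lo[OF i] by auto
    then show "linord {x\<in>X. P i x x} (P i)"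
      using linear_order_on_linord lo[OF i] unfolding P_def by fastforce
  next
    fix i x y assume i: "i < t" and "P i x y"
    then show "P i x x" "P i y y" unfolding fld[OF i] unfolding P_def by (auto simp: Field_def)
  next
    fix x y assume "x \<in> X" "y \<in> X"
    then show "(x, y) \<in> r \<longleftrightarrow> \<not> (\<exists>i<t. P i y x \<and> x \<noteq> y)"
      using rR[of x y] f(1) by (auto simp: P_def)
  qed
  then show "\<exists>t P. local_family X r d t P" using local_family_mono d' by blast
next
  assume "\<exists>t P. local_family X r d t P"
  then obtain t P where lf: "local_family X r d t P" by blast
  define A where "A i = {x\<in>X. P i x x}" for i
  define f where "f i = {(x, y). x \<in> A i \<and> y \<in> A i \<and> P i x y}" for i
  have lin: "linord (A i) (P i)" if "i < t" for i
    using lf that unfolding local_family_def A_def by blast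
  have fld: "Field (f i) = A i" for i by (auto simp: Field_def f_def A_def)
  have fP: "(x, y) \<in> f i \<longleftrightarrow> P i x y" if "i < t" "x \<in> X" "y \<in> X" for i x y
    using lf that unfolding local_family_def f_def A_def by blast
  have rP: "(x, y) \<in> r \<longleftrightarrow> \<not> (\<exists>i<t. P i y x \<and> x \<noteq> y)" if "x \<in> X" "y \<in> X" for x y
    using lf that unfolding local_family_def by blast
  have "local_realizer X r d (f ` {..<t})"
    unfolding local_realizer_def
  proof (intro conjI ballI)
    show "finite (f ` {..<t})" by simp
  next
    fix L assume "L \<in> f ` {..<t}"
    then obtain i where i: "i < t" "L = f i" by auto
    have "linear_order_on (A i) L"
      using linord_linear_order_on[OF lin] i by (simp add: f_def)
    moreover have "Restr r (A i) \<subseteq> L"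
    proof clarify
      fix x y assume xy: "(x, y) \<in> r" "x \<in> A i" "y \<in> A i"
      then have "x \<in> X" "y \<in> X" by (auto simp: A_def)
      \<comment> \<open>A related pair is never reversed, so totality on \<open>A i\<close> puts it
        in the order of \<open>r\<close>.\<close>
      then have "x = y \<or> \<not> P i y x" using rP xy(1) i(1) by blast
      then have "P i x y" using linord_total[OF lin[OF i(1)] xy(2,3)] by blast
      then show "(x, y) \<in> L" using xy i(2) by (simp add: f_def)
    qed
    moreover have "A i \<subseteq> X" by (auto simp: A_def)
    ultimately show "partial_linear_extension X r L"
      unfolding partial_linear_extension_def by blast
  next
    fix x assume x: "x \<in> X"
    have "{L \<in> f ` {..<t}. x \<in> Field L} = f ` {i. i < t \<and> P i x x}"
      using fld x by (auto simp: A_def)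
    \<comment> \<open>Here \<open>f\<close> may repeat a relation, which can only decrease the
      count.\<close>
    also have "card \<dots> \<le> card {i. i < t \<and> P i x x}" by (rule card_image_le) simp
    also have "\<dots> \<le> d" using lf x unfolding local_family_def by blast
    finally show "card {L \<in> f ` {..<t}. x \<in> Field L} \<le> d" .
  next
    fix x y assume xy: "x \<in> X" "y \<in> X"
    have "(\<exists>L\<in>f ` {..<t}. (y, x) \<in> L \<and> x \<noteq> y) \<longleftrightarrow> (\<exists>i<t. (y, x) \<in> f i \<and> x \<noteq> y)" by auto
    also have "\<dots> \<longleftrightarrow> (\<exists>i<t. P i y x \<and> x \<noteq> y)" using fP xy by blast
    finally show "(x, y) \<in> r \<longleftrightarrow> \<not> (\<exists>L\<in>f ` {..<t}. (y, x) \<in> L \<and> x \<noteq> y)"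
      using rP[OF xy] by simp
  qed
  then show "local_dim X r \<le> enat d" unfolding local_dim_def INF_enat_le_iff by blast
qed

section \<open>Compactness for both dimensions\<close>

text \<open>The comparisons (\<open>Inl\<close>) and the truth table (\<open>Inr\<close>) form one
  two-valued function, so a single formula is found for all finite subsets at once. The axioms of a
  linear order involve at most three elements and are checked on finite subsets.\<close>

lemma boolean_dim_compact:
  assumes fin: "\<And>F. finite F \<Longrightarrow> F \<subseteq> X \<Longrightarrow> boolean_dim F (Restr r F) \<le> enat n"
  shows "boolean_dim X r \<le> enat n"
proof -
  define M where "M f i x y \<longleftrightarrow> f (Inl (i, x, y))" for f :: "nat \<times> 'a \<times> 'a + nat set \<Rightarrow> bool" and i x y
  define \<phi> where "\<phi> f S \<longleftrightarrow> f (Inr S)" for f :: "nat \<times> 'a \<times> 'a + nat set \<Rightarrow> bool" and S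
  have "\<exists>f. \<forall>F. finite F \<and> F \<subseteq> X \<longrightarrow> boolean_family F r n (M f) (\<phi> f)"
  proof (rule directed_compactness)
    fix F assume F: "finite F" "F \<subseteq> X"
    then obtain M' \<phi>' where "boolean_family F (Restr r F) n M' \<phi>'"
      using fin[OF F] unfolding boolean_dim_le_iff by blast
    then have "boolean_family F r n M' \<phi>'" by (auto simp: boolean_family_def)
    moreover define f where "f = case_sum (\<lambda>(i, x, y). M' i x y) \<phi>'"
    moreover have "M f = M'" "\<phi> f = \<phi>'" by (simp_all add: fun_eq_iff M_def \<phi>_def f_def)
    ultimately show "\<exists>f. boolean_family F r n (M f) (\<phi> f)" by metis
    define S where "S = Inl ` ({..<n} \<times> F \<times> F) \<union> Inr ` Pow {..<n}"
    have "boolean_family F r n (M g) (\<phi> g)"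
      if "\<forall>i\<in>S. f i = g i" "boolean_family F r n (M f) (\<phi> f)" for f g
      using that(2) by (rule boolean_family_cong) (use that(1) in \<open>auto simp: M_def \<phi>_def S_def\<close>)
    moreover have "finite S" using F by (simp add: S_def)
    ultimately show "\<exists>S. finite S \<and> (\<forall>f g. (\<forall>i\<in>S. f i = g i) \<longrightarrow>
        boolean_family F r n (M f) (\<phi> f) \<longrightarrow> boolean_family F r n (M g) (\<phi> g))"
      by blast
  next
    fix F F' f assume "F \<subseteq> F'" "boolean_family F' r n (M f) (\<phi> f)"
    then show "boolean_family F r n (M f) (\<phi> f)"
      using boolean_family_subset by blast
  qed
  then obtain f where f: "\<And>F. finite F \<Longrightarrow> F \<subseteq> X \<Longrightarrow> boolean_family F r n (M f) (\<phi> f)" by blast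
  have "boolean_family X r n (M f) (\<phi> f)"
    unfolding boolean_family_def
  proof (intro conjI allI impI ballI)
    fix i assume i: "i < n"
    have lin: "linord F (M f i)" if "finite F" "F \<subseteq> X" for F
      using f[OF that] i by (simp add: boolean_family_def)
    show "linord X (M f i)"
    proof (rule linordI)
      show "M f i x x" if "x \<in> X" for x using linord_refl[OF lin[of "{x}"]] that by simp
      show "M f i x y \<or> M f i y x" if "x \<in> X" "y \<in> X" for x y
        using linord_total[OF lin[of "{x, y}"], of x y] that by simp
      show "x = y" if "x \<in> X" "y \<in> X" "M f i x y" "M f i y x" for x y
        using linord_antisym[OF lin[of "{x, y}"], of x y] that by simp
      show "M f i x z" if "x \<in> X" "y \<in> X" "z \<in> X" "M f i x y" "M f i y z" for x y z
        using linord_trans[OF lin[of "{x, y, z}"], of x y z] that by simp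
    qed
  next
    fix x y assume "x \<in> X" "y \<in> X"
    then show "(x, y) \<in> r \<longleftrightarrow> \<phi> f {i. i < n \<and> M f i x y}"
      using f[of "{x, y}"] by (simp add: boolean_family_def)
  qed
  then show ?thesis using boolean_dim_le_iff by blast
qed

text \<open>With \<open>t\<close> fixed in advance the limit is again a family of \<open>t\<close>
  partial orders; their ground sets are encoded along with them, by \<open>P i x x\<close>.\<close>

lemma local_family_compact:
  assumes fin: "\<And>F. finite F \<Longrightarrow> F \<subseteq> X \<Longrightarrow> \<exists>P. local_family F r d t P"
  shows "\<exists>P. local_family X r d t P"
proof -
  define M where "M f i x y \<longleftrightarrow> f (i, x, y)" for f :: "nat \<times> 'a \<times> 'a \<Rightarrow> bool" and i x y
  have "\<exists>f. \<forall>F. finite F \<and> F \<subseteq> X \<longrightarrow> local_family F r d t (M f)"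
  proof (rule directed_compactness)
    fix F assume F: "finite F" "F \<subseteq> X"
    then obtain P where "local_family F r d t P" using fin by blast
    moreover have "M (\<lambda>(i, x, y). P i x y) = P" by (simp add: fun_eq_iff M_def)
    ultimately show "\<exists>f. local_family F r d t (M f)" by metis
    define S where "S = {..<t} \<times> F \<times> F"
    have "local_family F r d t (M g)"
      if "\<forall>i\<in>S. f i = g i" "local_family F r d t (M f)" for f g
      using that(2) by (rule local_family_cong) (use that(1) in \<open>auto simp: M_def S_def\<close>)
    moreover have "finite S" using F by (simp add: S_def)
    ultimately show "\<exists>S. finite S \<and> (\<forall>f g. (\<forall>i\<in>S. f i = g i) \<longrightarrow>
        local_family F r d t (M f) \<longrightarrow> local_family F r d t (M g))"
      by blast
  next
    fix F F' f assume "F \<subseteq> F'" "local_family F' r d t (M f)"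
    then show "local_family F r d t (M f)"
      using local_family_subset by blast
  qed
  then obtain f where f: "\<And>F. finite F \<Longrightarrow> F \<subseteq> X \<Longrightarrow> local_family F r d t (M f)" by blast
  have "local_family X r d t (M f)"
    unfolding local_family_def
  proof (intro conjI allI impI ballI)
    fix i assume i: "i < t"
    have lin: "linord {x\<in>F. M f i x x} (M f i)" if "finite F" "F \<subseteq> X" for F
      using f[OF that] i by (simp add: local_family_def)
    show "linord {x\<in>X. M f i x x} (M f i)"
    proof (rule linordI)
      show "M f i x x" if "x \<in> {x\<in>X. M f i x x}" for x using that by simp
      show "M f i x y \<or> M f i y x" if "x \<in> {x\<in>X. M f i x x}" "y \<in> {x\<in>X. M f i x x}" for x y
        using linord_total[OF lin[of "{x, y}"], of x y] that by simp
      show "x = y"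
        if "x \<in> {x\<in>X. M f i x x}" "y \<in> {x\<in>X. M f i x x}" "M f i x y" "M f i y x" for x y
        using linord_antisym[OF lin[of "{x, y}"], of x y] that by simp
      show "M f i x z"
        if "x \<in> {x\<in>X. M f i x x}" "y \<in> {x\<in>X. M f i x x}" "z \<in> {x\<in>X. M f i x x}"
          "M f i x y" "M f i y z" for x y z
        using linord_trans[OF lin[of "{x, y, z}"], of x y z] that by simp
    qed
  next
    fix i x y assume "i < t" "x \<in> X" "y \<in> X" "M f i x y"
    then show "M f i x x" "M f i y y" using f[of "{x, y}"] unfolding local_family_def by blast+
  next
    fix x y assume "x \<in> X" "y \<in> X"
    then show "(x, y) \<in> r \<longleftrightarrow> \<not> (\<exists>i<t. M f i y x \<and> x \<noteq> y)"
      using f[of "{x, y}"] by (simp add: local_family_def)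
  next
    fix x assume "x \<in> X"
    then show "card {i. i < t \<and> M f i x x} \<le> d"
      using f[of "{x}"] by (simp add: local_family_def)
  qed
  then show ?thesis by blast
qed

section \<open>Passing to countable subposets\<close>

lemma boolean_dim_pullback:
  assumes "boolean_dim X r \<le> enat n" "inj_on h Y" "h ` Y \<subseteq> X"
    and "\<And>x y. x \<in> Y \<Longrightarrow> y \<in> Y \<Longrightarrow> (x, y) \<in> s \<longleftrightarrow> (h x, h y) \<in> r"
  shows "boolean_dim Y s \<le> enat n"
proof -
  obtain M \<phi> where "boolean_family X r n M \<phi>" using assms(1) boolean_dim_le_iff by blast
  then have "boolean_family Y s n (\<lambda>i x y. M i (h x) (h y)) \<phi>"
    using assms(2-4) by (rule boolean_family_pullback)
  then show ?thesis unfolding boolean_dim_le_iff by blast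
qed

lemma local_dim_pullback:
  assumes "local_dim X r \<le> enat d" "inj_on h Y" "h ` Y \<subseteq> X"
    and "\<And>x y. x \<in> Y \<Longrightarrow> y \<in> Y \<Longrightarrow> (x, y) \<in> s \<longleftrightarrow> (h x, h y) \<in> r"
  shows "local_dim Y s \<le> enat d"
proof -
  obtain t P where "local_family X r d t P" using assms(1) local_dim_le_iff by blast
  then have "local_family Y s d t (\<lambda>i x y. P i (h x) (h y))"
    using assms(2-4) by (rule local_family_pullback)
  then show ?thesis unfolding local_dim_le_iff by blast
qed

lemma partial_order_on_pullback:
  assumes r: "partial_order_on X r" and h: "inj_on h Y" "h ` Y \<subseteq> X"
  shows "partial_order_on Y {(x, y). x \<in> Y \<and> y \<in> Y \<and> (h x, h y) \<in> r}"
    (is "partial_order_on Y ?s")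
proof -
  have r': "refl_on X r" "trans r" "antisym r"
    using r unfolding partial_order_on_def preorder_on_def by auto
  have "refl_on Y ?s" using refl_onD[OF r'(1)] h(2) by (auto simp: refl_on_def)
  moreover have "trans ?s" using transD[OF r'(2)] by (fastforce intro!: transI)
  moreover have "antisym ?s" using antisymD[OF r'(3)] inj_onD[OF h(1)] by (fastforce intro!: antisymI)
  ultimately show ?thesis unfolding partial_order_on_def preorder_on_def by auto
qed

text \<open>The upper bound passes to subposets, whereas the lower bound has to be secured by a
  witness.\<close>

lemma local_dim_eq_3_iff: "local_dim X r = 3 \<longleftrightarrow> local_dim X r \<le> enat 3 \<and> \<not> local_dim X r \<le> enat 2"
  by (cases "local_dim X r") (auto simp: numeral_eq_enat)

text \<open>If every countable subset had a realizer of width \<open>d\<close>, the numbers of partial linear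
  extensions used would be bounded (take the union of finite subsets that need ever more of them),
  and compactness would give a finite realizer for \<open>X\<close>.\<close>

lemma local_dim_countable_witness:
  assumes "\<not> local_dim X r \<le> enat d"
  shows "\<exists>Y\<subseteq>X. countable Y \<and> \<not> local_dim Y r \<le> enat d"
proof (rule ccontr)
  assume "\<not> ?thesis"
  then have ctbl: "local_dim Y r \<le> enat d" if "Y \<subseteq> X" "countable Y" for Y using that by blast
  have "\<exists>t. \<forall>F. finite F \<and> F \<subseteq> X \<longrightarrow> (\<exists>P. local_family F r d t P)"
  proof (rule ccontr)
    assume "\<not> ?thesis"
    then have "\<forall>t. \<exists>F. finite F \<and> F \<subseteq> X \<and> \<not> (\<exists>P. local_family F r d t P)" by blast
    then obtain F where F: "\<And>t. finite (F t)" "\<And>t. F t \<subseteq> X"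
        "\<And>t P. \<not> local_family (F t) r d t P"
      by metis
    have "local_dim (\<Union>t. F t) r \<le> enat d"
      using F(1,2) by (intro ctbl) (auto intro: countable_finite)
    \<comment> \<open>The \<open>t\<close> obtained here selects the set \<open>F t\<close>, which
      admits no family of \<open>t\<close> partial orders.\<close>
    then obtain t P where "local_family (\<Union>t. F t) r d t P" unfolding local_dim_le_iff by blast
    then have "local_family (F t) r d t P" by (rule local_family_subset) blast
    then show False using F(3) by blast
  qed
  then obtain t where "\<And>F. finite F \<Longrightarrow> F \<subseteq> X \<Longrightarrow> \<exists>P. local_family F r d t P" by blast
  then have "\<exists>P. local_family X r d t P" by (rule local_family_compact)
  then show False using assms unfolding local_dim_le_iff by blast
qed

text \<open>The hypothesis speaks of local dimension exactly 3, which a finite subset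
  \<open>F\<close> may lack. Adding a countable subset of local dimension above 2 restores it, and
  the countable union is copied into the naturals.\<close>

lemma bounds_boolean_dim_transfer:
  assumes C: "bounds_boolean_dim TYPE(nat) C"
  shows "bounds_boolean_dim TYPE('a) C"
  unfolding bounds_boolean_dim_def
proof (intro allI impI, elim conjE)
  fix X :: "'a set" and r
  assume po: "partial_order_on X r" and "local_dim X r = 3"
  then have le3: "local_dim X r \<le> enat 3" and "\<not> local_dim X r \<le> enat 2"
    unfolding local_dim_eq_3_iff by blast+
  then obtain Y where Y: "Y \<subseteq> X" "countable Y" "\<not> local_dim Y r \<le> enat 2"
    using local_dim_countable_witness by blast
  show "boolean_dim X r \<le> enat C"
  proof (rule boolean_dim_compact)
    fix F assume F: "finite F" "F \<subseteq> X"
    define Z where "Z = Y \<union> F"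
    have Z: "Z \<subseteq> X" "countable Z" using Y F by (auto simp: Z_def countable_finite)
    obtain e :: "'a \<Rightarrow> nat" where e: "inj_on e Z" using Z(2) by (rule countableE)
    define h where "h = inv_into Z e"
    define s where "s = {(a, b). a \<in> e ` Z \<and> b \<in> e ` Z \<and> (h a, h b) \<in> r}"
    have h: "inj_on h (e ` Z)" "h ` e ` Z \<subseteq> X"
      using e Z(1) by (auto simp: h_def inj_on_inv_into)
    have es: "(x, y) \<in> r \<longleftrightarrow> (e x, e y) \<in> s" if "x \<in> Z" "y \<in> Z" for x y
      using that e by (simp add: s_def h_def)
    have "partial_order_on (e ` Z) s"
      unfolding s_def using po h by (rule partial_order_on_pullback)
    moreover have "local_dim (e ` Z) s \<le> enat 3"
      using le3 h by (rule local_dim_pullback) (simp add: s_def)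
    moreover have "\<not> local_dim (e ` Z) s \<le> enat 2"
    proof
      assume "local_dim (e ` Z) s \<le> enat 2"
      then have "local_dim Y r \<le> enat 2"
        by (rule local_dim_pullback[where h = e])
          (use e es in \<open>auto simp: Z_def intro: inj_on_subset\<close>)
      then show False using Y(3) by blast
    qed
    ultimately have "boolean_dim (e ` Z) s \<le> enat C"
      using C unfolding bounds_boolean_dim_def local_dim_eq_3_iff by blast
    then show "boolean_dim F (Restr r F) \<le> enat C"
      by (rule boolean_dim_pullback[where h = e])
        (use e es in \<open>auto simp: Z_def intro: inj_on_subset\<close>)
  qed
qed

section \<open>Linear orders from keys\<close>

text \<open>For each key function, two linear orders: by increasing and by decreasing keys, both refined
  within a key \<open>v\<close> by \<open>P v\<close>. They agree that \<open>y\<close> precedes \<open>x\<close> exactly if \<open>x\<close> and \<open>y\<close> have the same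
  key \<open>v\<close> and \<open>P v y x\<close>.\<close>

lemma boolean_dim_le_keys_nat:
  fixes g :: "nat \<Rightarrow> 'a \<Rightarrow> nat option"
  assumes lf: "local_family X r d t P"
    and key: "\<And>j x v. j < N \<Longrightarrow> x \<in> X \<Longrightarrow> g j x = Some v \<Longrightarrow> v < t \<and> P v x x"
    and det: "\<And>x y v. x \<in> X \<Longrightarrow> y \<in> X \<Longrightarrow> x \<noteq> y \<Longrightarrow> v < t \<Longrightarrow> P v x y \<Longrightarrow>
      \<exists>j<N. \<exists>w. g j x = Some w \<and> g j y = Some w \<and> P w x y"
  shows "boolean_dim X r \<le> enat (2 * N)"
proof -
  obtain W where W: "linord X W" using ex_linord by blast
  have W': "linord X (\<lambda>x y. W y x)"
    by (rule linordI)
      (use linord_refl[OF W] linord_total[OF W] linord_antisym[OF W] linord_trans[OF W] in blast)+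
  have lin: "linord {x\<in>X. P v x x} (P v)" if "v < t" for v
    using lf that unfolding local_family_def by blast
  \<comment> \<open>The value -1 collects the elements without a key in one fibre.\<close>
  define k :: "nat \<Rightarrow> 'a \<Rightarrow> int" where "k j x = (case g j x of None \<Rightarrow> -1 | Some v \<Rightarrow> int v)" for j x
  have kneg: "k j x < 0 \<longleftrightarrow> g j x = None" for j x by (simp add: k_def split: option.split)
  have kpos: "g j x = Some (nat (k j x))" if "\<not> k j x < 0" for j x
    using that by (simp add: k_def split: option.splits)
  define Q where "Q V a = (if a < 0 then V else P (nat a))" for V :: "'a \<Rightarrow> 'a \<Rightarrow> bool" and a :: int
  have Q: "linord {x\<in>X. k j x = a} (Q V a)" if "linord X V" "j < N" for j a V
  proof (cases "a < 0")
    case True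
    then show ?thesis using linord_subset[OF that(1)] by (simp add: Q_def)
  next
    case False
    show ?thesis
    \<comment> \<open>If no element has key \<open>a\<close>, then \<open>nat a\<close> need not be
      below \<open>t\<close>, but the fibre is empty.\<close>
    proof (cases "{x\<in>X. k j x = a} = {}")
      case True
      show ?thesis unfolding True by (simp add: linord_def)
    next
      case nonempty: False
      have *: "nat a < t \<and> P (nat a) x x" if "x \<in> X" "k j x = a" for x
        using key[OF \<open>j < N\<close> that(1), of "nat a"] kpos[of j x] that(2) False by simp
      then have "nat a < t" using nonempty by blast
      then have "linord {x\<in>X. P (nat a) x x} (P (nat a))" by (rule lin)
      then have "linord {x\<in>X. k j x = a} (P (nat a))" by (rule linord_subset) (use * in blast)
      then show ?thesis using False by (simp add: Q_def)
    qed
  qed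
  define up where "up j x y \<longleftrightarrow> k j x < k j y \<or> k j x = k j y \<and> Q W (k j x) x y" for j x y
  \<comment> \<open>\<open>W\<close> is reversed here, so two keyless elements are never reversed in
    both orders. The double minus matches \<open>linord_lex\<close> for the function
    \<open>- k j\<close>.\<close>
  define dn where "dn j x y \<longleftrightarrow> - k j x < - k j y \<or> - k j x = - k j y \<and> Q (\<lambda>x y. W y x) (- (- k j x)) x y"
    for j x y
  have up: "linord X (up j)" if "j < N" for j
    unfolding up_def by (rule linord_lex[OF Q[OF W that]])
  have dn: "linord X (dn j)" if "j < N" for j
    unfolding dn_def
    by (rule linord_lex[of X "\<lambda>x. - k j x" "\<lambda>a. Q (\<lambda>x y. W y x) (- a)"])
      (use Q[OF W' that] in \<open>simp add: minus_equation_iff[of "k j _"] eq_commute[of "- _" "k j _"]\<close>)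
  have updn: "up j x y \<or> dn j x y \<longleftrightarrow> \<not> (\<exists>w. g j x = Some w \<and> g j y = Some w \<and> P w y x)"
    if j: "j < N" and x: "x \<in> X" and y: "y \<in> X" and neq: "x \<noteq> y" for j x y
  proof (cases "k j x = k j y")
    case False
    then have "up j x y \<or> dn j x y" by (auto simp: up_def dn_def)
    moreover have "g j x \<noteq> g j y" using False by (auto simp: k_def)
    ultimately show ?thesis by auto
  next
    case eq: True
    show ?thesis
    proof (cases "k j x < 0")
      case True
      then have "up j x y \<or> dn j x y"
        using eq linord_total[OF W x y] by (auto simp: up_def dn_def Q_def)
      then show ?thesis using True kneg by simp
    next
      case False
      define w where "w = nat (k j x)"
      have gx: "g j x = Some w" "g j y = Some w" using kpos[of j x] kpos[of j y] False eq by (auto simp: w_def)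
      then have w: "w < t" "P w x x" "P w y y" using key[OF j x] key[OF j y] by blast+
      have "up j x y \<or> dn j x y \<longleftrightarrow> P w x y" using eq False by (auto simp: up_def dn_def Q_def w_def)
      also have "\<dots> \<longleftrightarrow> \<not> P w y x"
        using linord_total[OF lin[OF w(1)], of x y] linord_antisym[OF lin[OF w(1)], of x y] x y w neq by auto
      finally show ?thesis using gx by simp
    qed
  qed
  define M where "M i = (if even i then up (i div 2) else dn (i div 2))" for i
  \<comment> \<open>A comparison fails exactly if, for some \<open>j\<close>, both orders
    \<open>2 * j\<close> and \<open>2 * j + 1\<close> contradict it.\<close>
  define \<phi> where "\<phi> S \<longleftrightarrow> (\<forall>j<N. 2 * j \<in> S \<or> 2 * j + 1 \<in> S)" for S :: "nat set"
  have "boolean_family X r (2 * N) M \<phi>"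
    unfolding boolean_family_def
  proof (intro conjI allI impI ballI)
    fix i assume "i < 2 * N"
    then have "i div 2 < N" by linarith
    then show "linord X (M i)" using up dn by (simp add: M_def)
  next
    fix x y assume xy: "x \<in> X" "y \<in> X"
    have "\<phi> {i. i < 2 * N \<and> M i x y} \<longleftrightarrow> (\<forall>j<N. up j x y \<or> dn j x y)"
      by (auto simp: \<phi>_def M_def)
    also have "\<dots> \<longleftrightarrow> (x, y) \<in> r"
    proof (cases "x = y")
      case True
      have "(x, x) \<in> r" using lf xy unfolding local_family_def by blast
      then show ?thesis using linord_refl[OF up] xy True by blast
    next
      case False
      have "(\<forall>j<N. up j x y \<or> dn j x y) \<longleftrightarrow> \<not> (\<exists>j<N. \<exists>w. g j x = Some w \<and> g j y = Some w \<and> P w y x)"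
        using updn[OF _ xy False] by blast
      also have "\<dots> \<longleftrightarrow> \<not> (\<exists>v<t. P v y x)"
        using det[OF xy(2,1) False[symmetric]] key[OF _ xy(1)] by blast
      also have "\<dots> \<longleftrightarrow> (x, y) \<in> r" using lf xy False unfolding local_family_def by blast
      finally show ?thesis .
    qed
    finally show "(x, y) \<in> r \<longleftrightarrow> \<phi> {i. i < 2 * N \<and> M i x y}" by simp
  qed
  then show ?thesis unfolding boolean_dim_le_iff by blast
qed

lemma boolean_dim_le_keys:
  fixes g :: "'j \<Rightarrow> 'a \<Rightarrow> nat option"
  assumes lf: "local_family X r d t P" and J: "finite J"
    and key: "\<And>j x v. j \<in> J \<Longrightarrow> x \<in> X \<Longrightarrow> g j x = Some v \<Longrightarrow> v < t \<and> P v x x"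
    and det: "\<And>x y v. x \<in> X \<Longrightarrow> y \<in> X \<Longrightarrow> x \<noteq> y \<Longrightarrow> v < t \<Longrightarrow> P v x y \<Longrightarrow>
      \<exists>j\<in>J. \<exists>w. g j x = Some w \<and> g j y = Some w \<and> P w x y"
  shows "boolean_dim X r \<le> enat (2 * card J)"
proof -
  obtain b where b: "bij_betw b {0..<card J} J" using ex_bij_betw_nat_finite[OF J] by blast
  then have bJ: "b ` {0..<card J} = J" by (rule bij_betw_imp_surj_on)
  show ?thesis
  proof (rule boolean_dim_le_keys_nat[OF lf, where g = "\<lambda>i. g (b i)"])
    show "v < t \<and> P v x x" if "i < card J" "x \<in> X" "g (b i) x = Some v" for i x v
      by (rule key[of "b i"]) (use that bJ in auto)
    show "\<exists>i<card J. \<exists>w. g (b i) x = Some w \<and> g (b i) y = Some w \<and> P w x y"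
      if xy: "x \<in> X" "y \<in> X" "x \<noteq> y" "v < t" "P v x y" for x y v
    proof -
      obtain j w where "j \<in> J" "g j x = Some w \<and> g j y = Some w \<and> P w x y" using det[OF xy] by blast
      moreover from this obtain i where "i < card J" "j = b i" using bJ by force
      ultimately show ?thesis by blast
    qed
  qed
qed

section \<open>Choosing the keys\<close>

lemma finite_subset_image_lessThan:
  assumes "finite K" "card K \<le> n"
  shows "\<exists>e. K \<subseteq> e ` {..<n::nat}"
proof -
  obtain e where "bij_betw e {0..<card K} K" using ex_bij_betw_nat_finite[OF assms(1)] by blast
  then have "K = e ` {0..<card K}" by (simp add: bij_betw_imp_surj_on)
  also have "\<dots> \<subseteq> e ` {..<n}" using assms(2) by (intro image_mono) auto
  finally show ?thesis by blast
qed

section \<open>The case of an index common to all elements\<close>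

text \<open>Cut the line greedily: each block ends at the farthest right end of an \<open>I\<close>-pair that starts
  before the block. Such a pair \<open>(x, y)\<close> spans the block, so \<open>T x \<union> T y\<close> meets \<open>T z\<close> for all \<open>z\<close> in
  it, and no \<open>I\<close>-pair can jump over a block.\<close>

lemma greedy_blocks:
  fixes rk :: "'a \<Rightarrow> nat" and T :: "'a \<Rightarrow> nat set"
  assumes fin: "finite X" and inj: "inj_on rk X"
    and I: "\<And>x y. I x y \<Longrightarrow> x \<in> X \<and> y \<in> X \<and> rk x < rk y"
    and T: "\<And>x. x \<in> X \<Longrightarrow> finite (T x) \<and> card (T x) \<le> 2"
    and between: "\<And>x y z. I x y \<Longrightarrow> z \<in> X \<Longrightarrow> rk x \<le> rk z \<Longrightarrow> rk z \<le> rk y \<Longrightarrow> T z \<inter> (T x \<union> T y) \<noteq> {}"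
  shows "\<exists>(b :: 'a \<Rightarrow> nat) e. (\<forall>x\<in>X. card (T x - e (b x) ` {..<4::nat}) \<le> 1) \<and>
    (\<forall>x y. I x y \<longrightarrow> b y = b x \<or> b y = Suc (b x))"
proof -
  \<comment> \<open>Blocks will be half-open intervals of ranks, hence the \<open>+ 1\<close> past
    the right end.\<close>
  define ends where "ends s = {rk y + 1 | x y. I x y \<and> rk x < s}" for s
  have fin_ends: "finite (ends s)" for s
    by (rule finite_subset[of _ "(\<lambda>y. rk y + 1) ` X"]) (use fin I in \<open>auto simp: ends_def\<close>)
  \<comment> \<open>The value \<open>s + 1\<close> guarantees progress if no pair starting before
    \<open>s\<close> reaches beyond it.\<close>
  define f where "f s = Max (insert (s + 1) (ends s))" for s
  have f_gt: "s < f s" for s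
  proof -
    have "s + 1 \<le> f s" unfolding f_def by (rule Max_ge) (use fin_ends in simp_all)
    then show ?thesis by simp
  qed
  have f_end: "rk y < f s" if "I x y" "rk x < s" for x y s
  proof -
    have "rk y + 1 \<in> ends s" using that by (auto simp: ends_def)
    then have "rk y + 1 \<le> f s" unfolding f_def by (intro Max_ge) (use fin_ends in simp_all)
    then show ?thesis by simp
  qed
  have f_cases: "f s = s + 1 \<or> (\<exists>x y. I x y \<and> rk x < s \<and> f s = rk y + 1)" for s
    using Max_in[of "insert (s + 1) (ends s)"] fin_ends by (auto simp: f_def ends_def)
  define S where "S k = (f ^^ k) 0" for k
  have S0: "S 0 = 0" and SS: "S (Suc k) = f (S k)" for k by (simp_all add: S_def)
  have S_ge: "k \<le> S k" for k
  proof (induction k)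
    case (Suc k)
    then show ?case using f_gt[of "S k"] by (simp add: SS)
  qed simp
  define b where "b x = (LEAST k. rk x < S (Suc k))" for x
  \<comment> \<open>The cuts grow at least as fast as their indices, so every rank lies before some
    cut.\<close>
  have b_lt: "rk x < S (Suc (b x))" for x
    unfolding b_def by (rule LeastI[of _ "rk x"]) (use S_ge[of "Suc (rk x)"] in simp)
  have b_le: "b x \<le> k" if "rk x < S (Suc k)" for x k
    unfolding b_def using that by (rule Least_le)
  have b_ge: "S (b x) \<le> rk x" for x
  proof (cases "b x")
    case (Suc m)
    then show ?thesis using b_le[of x m] by (cases "rk x < S (Suc m)") auto
  qed (simp add: S0)
  \<comment> \<open>The left end lies before the cut closing its block, so by the choice of the next
    cut the right end lies before that one.\<close>
  have bI: "b y = b x \<or> b y = Suc (b x)" if "I x y" for x y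
  proof -
    have "rk y < S (Suc (Suc (b x)))" using f_end[OF that b_lt] by (simp add: SS)
    then have "b y \<le> Suc (b x)" by (rule b_le)
    moreover have "b x \<le> b y" using I[OF that] b_lt[of y] by (intro b_le) simp
    ultimately show ?thesis by linarith
  qed
  have "\<exists>e. \<forall>z\<in>X. b z = k \<longrightarrow> card (T z - e ` {..<4::nat}) \<le> 1" for k
  proof -
    have "\<exists>K. finite K \<and> card K \<le> 4 \<and> (\<forall>z\<in>X. b z = k \<longrightarrow> card (T z - K) \<le> 1)"
      using f_cases[of "S k"]
    proof (elim disjE exE conjE)
      \<comment> \<open>A block of one rank has at most one element, whose at most two indices serve
        as \<open>K\<close>.\<close>
      assume "f (S k) = S k + 1"
      then have rk: "rk z = S k" if "b z = k" for z
        using b_ge[of z] b_lt[of z] that by (simp add: SS)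
      show ?thesis
      proof (cases "\<exists>z\<in>X. b z = k")
        case True
        then obtain z0 where z0: "z0 \<in> X" "b z0 = k" by blast
        have "z = z0" if "z \<in> X" "b z = k" for z
          using inj_onD[OF inj] rk[OF that(2)] rk[OF z0(2)] that(1) z0(1) by simp
        then show ?thesis using T[OF z0(1)] by (intro exI[of _ "T z0"]) auto
      next
        case False
        then show ?thesis by (intro exI[of _ "{}"]) auto
      qed
    next
      \<comment> \<open>The pair starts before the block and ends at its last rank, so
        \<open>between\<close> applies throughout; two sets of at most two indices give the
        4.\<close>
      fix x y assume xy: "I x y" "rk x < S k" "f (S k) = rk y + 1"
      have X: "x \<in> X" "y \<in> X" using I[OF xy(1)] by auto
      have "card (T z - (T x \<union> T y)) \<le> 1" if z: "z \<in> X" "b z = k" for z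
      proof -
        have "rk x \<le> rk z" "rk z \<le> rk y"
          using b_ge[of z] b_lt[of z] xy(2,3) z(2) by (simp_all add: SS)
        then obtain a where a: "a \<in> T z" "a \<in> T x \<union> T y" using between[OF xy(1) z(1)] by blast
        have "card (T z - (T x \<union> T y)) \<le> card (T z - {a})"
          using T[OF z(1)] a by (intro card_mono) auto
        also have "\<dots> = card (T z) - 1" using a(1) by (rule card_Diff_singleton)
        also have "\<dots> \<le> 1" using T[OF z(1)] by linarith
        finally show ?thesis .
      qed
      moreover have "card (T x \<union> T y) \<le> 4"
        using card_Un_le[of "T x" "T y"] T[OF X(1)] T[OF X(2)] by linarith
      moreover have "finite (T x \<union> T y)" using T X by blast
      ultimately show ?thesis by blast
    qed
    then obtain K where K: "finite K" "card K \<le> 4" "\<And>z. z \<in> X \<Longrightarrow> b z = k \<Longrightarrow> card (T z - K) \<le> 1" by blast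
    obtain e where e: "K \<subseteq> e ` {..<4::nat}" using finite_subset_image_lessThan[OF K(1,2)] by blast
    have "card (T z - e ` {..<4}) \<le> 1" if z: "z \<in> X" "b z = k" for z
    proof -
      have "card (T z - e ` {..<4}) \<le> card (T z - K)" using T[OF z(1)] e by (intro card_mono) auto
      then show ?thesis using K(3)[OF z] by linarith
    qed
    then show ?thesis by blast
  qed
  then obtain e where "\<And>k z. z \<in> X \<Longrightarrow> b z = k \<Longrightarrow> card (T z - e k ` {..<4::nat}) \<le> 1" by metis
  then show ?thesis using bI by blast
qed

lemma card_le_1_eq_singleton: "finite A \<Longrightarrow> card A \<le> 1 \<Longrightarrow> a \<in> A \<Longrightarrow> A = {a}"
  using card_le_Suc0_iff_eq[of A] by auto

text \<open>The 26 keys are the constant \<open>v0\<close> and, for roles \<open>p, q < 5\<close>, role \<open>p\<close> in even and role \<open>q\<close> in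
  odd blocks. Roles \<open>0, \<dots>, 3\<close> are the indices covering the block, role 4 is the remaining index.
  Within a block a common index has a common role, and adjacent blocks differ in parity.\<close>

lemma boolean_dim_star:
  assumes lf: "local_family X r 3 t P" and r: "trans r" and fin: "finite X"
    and v0: "v0 < t" "\<And>x. x \<in> X \<Longrightarrow> P v0 x x"
  shows "boolean_dim X r \<le> enat 52"
proof -
  have PP: "P v x x \<and> P v y y" if "v < t" "x \<in> X" "y \<in> X" "P v x y" for v x y
    using lf that unfolding local_family_def by blast
  have rP: "(x, y) \<in> r \<longleftrightarrow> \<not> (\<exists>i<t. P i y x \<and> x \<noteq> y)" if "x \<in> X" "y \<in> X" for x y
    using lf that unfolding local_family_def by blast
  have "linord {x\<in>X. P v0 x x} (P v0)" using lf v0(1) unfolding local_family_def by blast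
  then have L: "linord X (P v0)" by (rule linord_subset) (use v0(2) in blast)
  define T where "T x = {v. v < t \<and> v \<noteq> v0 \<and> P v x x}" for x
  have T: "finite (T x) \<and> card (T x) \<le> 2" if "x \<in> X" for x
  proof -
    have "insert v0 (T x) = {v. v < t \<and> P v x x}" using v0 that by (auto simp: T_def)
    moreover have "card {v. v < t \<and> P v x x} \<le> 3" using lf that unfolding local_family_def by blast
    moreover have f: "finite (T x)" by (simp add: T_def)
    moreover have "v0 \<notin> T x" by (simp add: T_def)
    ultimately have "Suc (card (T x)) \<le> 3" by (metis card_insert_disjoint)
    then show ?thesis using f by simp
  qed
  define rk where "rk x = card {z\<in>X. P v0 z x}" for x
  have rk_less: "rk x < rk y" if xy: "x \<in> X" "y \<in> X" "P v0 x y" "x \<noteq> y" for x y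
    unfolding rk_def
  proof (rule psubset_card_mono)
    have "{z\<in>X. P v0 z x} \<subseteq> {z\<in>X. P v0 z y}" using linord_trans[OF L _ xy(1,2) _ xy(3)] by blast
    moreover have "y \<notin> {z\<in>X. P v0 z x}" using linord_antisym[OF L xy(1,2,3)] xy(4) by blast
    moreover have "y \<in> {z\<in>X. P v0 z y}" using v0(2) xy(2) by blast
    ultimately show "{z\<in>X. P v0 z x} \<subset> {z\<in>X. P v0 z y}" by blast
  qed (use fin in simp)
  have rk_le: "P v0 x y" if xy: "x \<in> X" "y \<in> X" "rk x \<le> rk y" for x y
    using linord_total[OF L xy(1,2)] rk_less[OF xy(2,1)] xy(3) v0(2)[OF xy(1)] by fastforce
  have inj: "inj_on rk X"
    by (rule inj_onI) (use rk_le linord_antisym[OF L] in auto)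
  \<comment> \<open>These are the incomparable pairs, listed in the order of \<open>P v0\<close>:
    \<open>P v0\<close> rules out one direction and some \<open>P v\<close> the other.\<close>
  define I where "I x y \<longleftrightarrow> x \<in> X \<and> y \<in> X \<and> x \<noteq> y \<and> P v0 x y \<and> (\<exists>v<t. P v y x)" for x y
  have common: "v \<in> T x \<inter> T y" if "x \<in> X" "y \<in> X" "x \<noteq> y" "P v0 x y" "v < t" "P v y x" for x y v
  proof -
    have "v \<noteq> v0" using linord_antisym[OF L that(1,2,4)] that(3,6) by blast
    then show ?thesis using PP[OF that(5,2,1,6)] that(5) by (simp add: T_def)
  qed
  have below: "(x, y) \<in> r" if xy: "x \<in> X" "y \<in> X" "P v0 x y" "T x \<inter> T y = {}" for x y
    using rP[OF xy(1,2)] common[OF xy(1,2) _ xy(3)] xy(4) by blast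
  have between: "T z \<inter> (T x \<union> T y) \<noteq> {}"
    if "I x y" and z: "z \<in> X" "rk x \<le> rk z" "rk z \<le> rk y" for x y z
  proof
    assume disj: "T z \<inter> (T x \<union> T y) = {}"
    have X: "x \<in> X" "y \<in> X" using that(1) by (auto simp: I_def)
    \<comment> \<open>Without a shared index nothing reverses \<open>x\<close> and \<open>z\<close>,
      or \<open>z\<close> and \<open>y\<close>; transitivity would then make \<open>x\<close> and
      \<open>y\<close> comparable.\<close>
    have "(x, z) \<in> r" by (rule below[OF X(1) z(1) rk_le[OF X(1) z(1,2)]]) (use disj in blast)
    moreover have "(z, y) \<in> r" by (rule below[OF z(1) X(2) rk_le[OF z(1) X(2) z(3)]]) (use disj in blast)
    ultimately have "(x, y) \<in> r" by (rule transD[OF r])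
    then show False using rP[OF X] that(1) by (auto simp: I_def)
  qed
  obtain b :: "'a \<Rightarrow> nat" and e :: "nat \<Rightarrow> nat \<Rightarrow> nat"
    where b: "\<And>x. x \<in> X \<Longrightarrow> card (T x - e (b x) ` {..<4}) \<le> 1"
      and bI: "\<And>x y. I x y \<Longrightarrow> b y = b x \<or> b y = Suc (b x)"
  proof -
    have "\<exists>(b :: 'a \<Rightarrow> nat) e. (\<forall>x\<in>X. card (T x - e (b x) ` {..<4::nat}) \<le> 1) \<and>
        (\<forall>x y. I x y \<longrightarrow> b y = b x \<or> b y = Suc (b x))"
      by (rule greedy_blocks[OF fin inj _ T between]) (auto simp: I_def rk_less)
    then show ?thesis using that by blast
  qed
  \<comment> \<open>A role below 4 gives a key only where its index occurs. The choice in role 4 is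
    unambiguous on \<open>X\<close>, as at most one index lies outside the cover.\<close>
  define \<kappa> where "\<kappa> i x =
    (if i < 4 then if e (b x) i \<in> T x then Some (e (b x) i) else None
     else if T x \<subseteq> e (b x) ` {..<4} then None else Some (SOME v. v \<in> T x - e (b x) ` {..<4}))"
    for i :: nat and x
  have \<kappa>_T: "v \<in> T x" if "\<kappa> i x = Some v" for i x v
  proof (cases "i < 4")
    case True
    then show ?thesis using that by (auto simp: \<kappa>_def split: if_splits)
  next
    case False
    then have "v = (SOME v. v \<in> T x - e (b x) ` {..<4})" "T x - e (b x) ` {..<4} \<noteq> {}"
      using that by (auto simp: \<kappa>_def split: if_splits)
    then show ?thesis using some_in_eq[of "T x - e (b x) ` {..<4}"] by simp
  qed
  have hub: "\<kappa> i x = Some v" if "v \<in> T x" "i < 4" "v = e (b x) i" for v x i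
    using that by (simp add: \<kappa>_def)
  have outer: "\<kappa> 4 x = Some v" if "x \<in> X" "v \<in> T x" "v \<notin> e (b x) ` {..<4}" for v x
  proof -
    have "T x - e (b x) ` {..<4} = {v}"
      by (rule card_le_1_eq_singleton) (use T b that in auto)
    moreover from this have "\<not> T x \<subseteq> e (b x) ` {..<4}" by blast
    ultimately show ?thesis by (simp add: \<kappa>_def)
  qed
  have role: "\<exists>i<5. \<kappa> i x = Some v" if "x \<in> X" "v \<in> T x" for x v
  proof (cases "v \<in> e (b x) ` {..<4}")
    case True
    then obtain i where "i < 4" "v = e (b x) i" by auto
    then show ?thesis using hub[OF that(2)] by (intro exI[of _ i]) simp
  next
    case False
    then show ?thesis using outer[OF that] by (intro exI[of _ 4]) simp
  qed
  have same_role: "\<exists>i<5. \<kappa> i x = Some v \<and> \<kappa> i y = Some v"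
    if "x \<in> X" "y \<in> X" "v \<in> T x" "v \<in> T y" "b x = b y" for x y v
  proof (cases "v \<in> e (b x) ` {..<4}")
    case True
    then obtain i where "i < 4" "v = e (b x) i" by auto
    then show ?thesis using hub[OF that(3)] hub[OF that(4)] that(5) by (intro exI[of _ i]) simp
  next
    case False
    then show ?thesis using outer[OF that(1,3)] outer[OF that(2,4)] that(5) by (intro exI[of _ 4]) simp
  qed
  define g where "g j x = (case j of None \<Rightarrow> Some v0
      | Some (p, q) \<Rightarrow> if even (b x) then \<kappa> p x else \<kappa> q x)" for j x
  define J :: "(nat \<times> nat) option set" where "J = insert None (Some ` ({..<5} \<times> {..<5}))"
  have "boolean_dim X r \<le> enat (2 * card J)"
  proof (rule boolean_dim_le_keys[OF lf, where g = g])
    show "finite J" by (simp add: J_def)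
  next
    fix j x v assume x: "x \<in> X" and g: "g j x = Some v"
    show "v < t \<and> P v x x"
    proof (cases j)
      case None
      then show ?thesis using g v0 x by (simp add: g_def)
    next
      case (Some pq)
      then have "\<exists>i. \<kappa> i x = Some v" using g by (auto simp: g_def split: prod.splits if_splits)
      then have "v \<in> T x" using \<kappa>_T by blast
      then show ?thesis by (simp add: T_def)
    qed
  next
    fix x y v assume x: "x \<in> X" and y: "y \<in> X" and neq: "x \<noteq> y" and v: "v < t" "P v x y"
    show "\<exists>j\<in>J. \<exists>w. g j x = Some w \<and> g j y = Some w \<and> P w x y"
    proof (cases "P v0 x y")
      case True
      then show ?thesis by (intro bexI[of _ None]) (auto simp: g_def J_def)
    next
      case False
      \<comment> \<open>\<open>P v0\<close> has the opposite order, so \<open>v\<close> is a further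
        common index and the pair is incomparable.\<close>
      then have yx: "P v0 y x" using linord_total[OF L x y] by blast
      have vT: "v \<in> T x" "v \<in> T y" using common[OF y x neq[symmetric] yx v] by auto
      have "I y x" using x y neq yx v by (auto simp: I_def)
      then consider "b x = b y" | "even (b x) \<noteq> even (b y)" using bI by fastforce
      then show ?thesis
      proof cases
        case 1
        then obtain i where "i < 5" "\<kappa> i x = Some v" "\<kappa> i y = Some v"
          using same_role[OF x y vT] by blast
        then show ?thesis using v(2) by (intro bexI[of _ "Some (i, i)"]) (auto simp: g_def J_def)
      next
        case 2
        \<comment> \<open>Opposite parities let the two roles be chosen independently.\<close>
        obtain p q where pq: "p < 5" "q < 5" "\<kappa> p x = Some v" "\<kappa> q y = Some v"
          using role[OF x vT(1)] role[OF y vT(2)] by blast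
        show ?thesis
        proof (cases "even (b x)")
          case True
          then show ?thesis using 2 pq v(2) by (intro bexI[of _ "Some (p, q)"]) (auto simp: g_def J_def)
        next
          case False
          then show ?thesis using 2 pq v(2) by (intro bexI[of _ "Some (q, p)"]) (auto simp: g_def J_def)
        qed
      qed
    qed
  qed
  \<comment> \<open>One constant key and 5 * 5 pairs of roles; each key costs two orders.\<close>
  also have "card J = 26"
    by (simp add: J_def card_image card_insert_if image_iff)
  finally show ?thesis by simp
qed

section \<open>The case without a common index\<close>

text \<open>Every index set \<open>T y\<close> meets \<open>T x0\<close> in some \<open>k\<close>, and meets the set \<open>T (w k)\<close>, which avoids \<open>k\<close>.
  So two of its at most three indices lie in a set \<open>K\<close> of at most 12.\<close>

lemma boolean_dim_nonstar:
  assumes lf: "local_family X r 3 t P" and r: "antisym r"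
    and x0: "x0 \<in> X" and nonstar: "\<And>v. v < t \<Longrightarrow> \<exists>x\<in>X. \<not> P v x x"
  shows "boolean_dim X r \<le> enat 26"
proof -
  define T where "T x = {v. v < t \<and> P v x x}" for x
  have finT: "finite (T x)" for x by (simp add: T_def)
  have cardT: "card (T x) \<le> 3" if "x \<in> X" for x
    using lf that unfolding local_family_def T_def by blast
  have PP: "v \<in> T x \<and> v \<in> T y" if "v < t" "x \<in> X" "y \<in> X" "P v x y" for v x y
    using lf that unfolding local_family_def T_def by blast
  \<comment> \<open>By antisymmetry at least one direction fails, and the order reversing it
    contains both elements.\<close>
  have meet: "\<exists>v. v \<in> T x \<and> v \<in> T y" if xy: "x \<in> X" "y \<in> X" "x \<noteq> y" for x y
  proof -
    have "(x, y) \<notin> r \<or> (y, x) \<notin> r" using antisymD[OF r] xy(3) by blast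
    then have "\<exists>v<t. P v y x \<or> P v x y" using lf xy unfolding local_family_def by blast
    then show ?thesis using PP xy by blast
  qed
  obtain w where w: "\<And>v. v < t \<Longrightarrow> w v \<in> X \<and> \<not> P v (w v) (w v)" using nonstar by metis
  define K where "K = T x0 \<union> (\<Union>k\<in>T x0. T (w k))"
  have finK: "finite K" using finT by (simp add: K_def)
  have wT: "w k \<in> X" "k \<notin> T (w k)" if "k \<in> T x0" for k
    using w that by (auto simp: T_def)
  have "card (\<Union>k\<in>T x0. T (w k)) \<le> (\<Sum>k\<in>T x0. card (T (w k)))"
    by (rule card_UN_le) (rule finT)
  also have "\<dots> \<le> card (T x0) * 3"
    using sum_bounded_above[of "T x0" "\<lambda>k. card (T (w k))" 3] cardT wT(1) by simp
  also have "\<dots> \<le> 9" using cardT[OF x0] by simp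
  finally have "card K \<le> 12"
    using card_Un_le[of "T x0" "\<Union>k\<in>T x0. T (w k)"] cardT[OF x0] by (simp add: K_def)
  have outside: "card (T y - K) \<le> 1" if y: "y \<in> X" for y
  proof (cases "y = x0")
    case True
    then have "T y - K = {}" by (auto simp: K_def)
    then show ?thesis by (simp only: card.empty zero_le)
  next
    case False
    then obtain k where k: "k \<in> T y" "k \<in> T x0" using meet[OF y x0] by blast
    \<comment> \<open>The index \<open>k\<close> distinguishes \<open>y\<close> from
      \<open>w k\<close>; hence these two share an index, and it cannot be \<open>k\<close>.\<close>
    have "y \<noteq> w k" using wT(2)[OF k(2)] k(1) by blast
    then obtain c where c: "c \<in> T y" "c \<in> T (w k)" using meet[OF y wT(1)[OF k(2)]] by blast
    have "c \<noteq> k" using wT(2)[OF k(2)] c(2) by blast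
    have "card (T y - K) \<le> card (T y - {k, c})"
      using finT k c by (intro card_mono) (auto simp: K_def)
    also have "\<dots> = card (T y) - 2"
      using card_Diff_subset[of "{k, c}" "T y"] k(1) c(1) \<open>c \<noteq> k\<close> by simp
    also have "\<dots> \<le> 1" using cardT[OF y] by simp
    finally show ?thesis .
  qed
  \<comment> \<open>Each index in \<open>K\<close> is a key of its own; \<open>None\<close> chooses
    the one index that may be left outside \<open>K\<close>.\<close>
  define g where "g j x = (case j of
      None \<Rightarrow> if T x \<subseteq> K then None else Some (SOME v. v \<in> T x - K)
    | Some k \<Rightarrow> if k \<in> T x then Some k else None)" for j x
  have outer: "g None x = Some v" if "x \<in> X" "v \<in> T x" "v \<notin> K" for v x
  proof -
    have "T x - K = {v}"
      by (rule card_le_1_eq_singleton) (use finT outside that in auto)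
    moreover from this have "\<not> T x \<subseteq> K" by blast
    ultimately show ?thesis by (simp add: g_def)
  qed
  define J where "J = insert None (Some ` K)"
  have "boolean_dim X r \<le> enat (2 * card J)"
  proof (rule boolean_dim_le_keys[OF lf, where g = g])
    show "finite J" using finK by (simp add: J_def)
  next
    fix j x v assume x: "x \<in> X" and g: "g j x = Some v"
    have "v \<in> T x"
    proof (cases j)
      case None
      then have "v = (SOME v. v \<in> T x - K)" "T x - K \<noteq> {}"
        using g by (auto simp: g_def split: if_splits)
      then show ?thesis using some_in_eq[of "T x - K"] by simp
    next
      case (Some k)
      then show ?thesis using g by (auto simp: g_def split: if_splits)
    qed
    then show "v < t \<and> P v x x" by (simp add: T_def)
  next
    fix x y v assume x: "x \<in> X" and y: "y \<in> X" and v: "v < t" "P v x y"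
    then have vT: "v \<in> T x" "v \<in> T y" using PP by blast+
    show "\<exists>j\<in>J. \<exists>w. g j x = Some w \<and> g j y = Some w \<and> P w x y"
    proof (cases "v \<in> K")
      case True
      then show ?thesis using vT v(2) by (intro bexI[of _ "Some v"]) (auto simp: g_def J_def)
    next
      case False
      then show ?thesis
        using outer[OF x vT(1)] outer[OF y vT(2)] v(2) by (intro bexI[of _ None]) (auto simp: J_def)
    qed
  qed
  moreover have "card J \<le> 13"
    using finK \<open>card K \<le> 12\<close> by (simp add: J_def card_image card_insert_if image_iff)
  then have "enat (2 * card J) \<le> enat 26" by simp
  ultimately show ?thesis by (rule order_trans)
qed

section \<open>Combining the cases\<close>

lemma boolean_dim_finite_local_dim_3:
  assumes "finite X" "trans r" "antisym r" "local_dim X r \<le> enat 3"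
  shows "boolean_dim X r \<le> enat 52"
proof -
  obtain t P where lf: "local_family X r 3 t P" using assms(4) unfolding local_dim_le_iff by blast
  \<comment> \<open>The empty carrier is separate because the last case starts from some element
    \<open>x0\<close>.\<close>
  consider "X = {}" | v0 where "v0 < t" "\<And>x. x \<in> X \<Longrightarrow> P v0 x x"
    | x0 where "x0 \<in> X" "\<And>v. v < t \<Longrightarrow> \<exists>x\<in>X. \<not> P v x x"
    by blast
  then show ?thesis
  proof cases
    case 1
    then have "boolean_family X r 52 M \<phi>" for M \<phi> by (simp add: boolean_family_def linord_def)
    then show ?thesis unfolding boolean_dim_le_iff by blast
  next
    case 2
    then show ?thesis using boolean_dim_star[OF lf assms(2,1)] by blast
  next
    case 3
    then have "boolean_dim X r \<le> enat 26" using boolean_dim_nonstar[OF lf assms(3)] by blast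
    also have "\<dots> \<le> enat 52" by simp
    finally show ?thesis .
  qed
qed

text \<open>Local dimension at most 3 passes to finite subsets, where 52 orders suffice; compactness
  leads back to \<open>X\<close>.\<close>

lemma bounds_boolean_dim_52: "bounds_boolean_dim TYPE('a) 52"
  unfolding bounds_boolean_dim_def
proof (intro allI impI, elim conjE)
  fix X :: "'a set" and r
  assume "partial_order_on X r" and "local_dim X r = 3"
  then have r: "trans r" "antisym r" and le: "local_dim X r \<le> enat 3"
    unfolding partial_order_on_def preorder_on_def local_dim_eq_3_iff by auto
  show "boolean_dim X r \<le> enat 52"
  proof (rule boolean_dim_compact)
    fix F assume F: "finite F" "F \<subseteq> X"
    have "local_dim F r \<le> enat 3"
      using le by (rule local_dim_pullback[where h = "\<lambda>x. x"]) (use F in auto)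
    then have "boolean_dim F r \<le> enat 52"
      by (rule boolean_dim_finite_local_dim_3[OF F(1) r])
    then show "boolean_dim F (Restr r F) \<le> enat 52"
      by (rule boolean_dim_pullback[where h = "\<lambda>x. x"]) auto
  qed
qed

theorem mainTheorem3:
  shows "(\<exists>C. bounds_boolean_dim TYPE(nat) C) \<and>
         (\<forall>C. bounds_boolean_dim TYPE(nat) C \<longrightarrow> bounds_boolean_dim TYPE('a) C)"
  \<comment> \<open>The second conjunct concerns every \<open>C\<close>, possibly below 52, and
    therefore rests on the transfer between types.\<close>
  using bounds_boolean_dim_52 bounds_boolean_dim_transfer by blast

end
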